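(* Let $a\ge 2$ be an integer. (1) The mean value and the variance of $Z_N(a)$ are \[ \mu_N(a)={\bf E}Z_N(a)=\frac12\left[a\,\frac{a^N-1}{a-1}-N\right],\qquad \sigma_N^2(a)={\bf Var}\,Z_N(a)=\frac1{12}\left[a^2\,\frac{1-a^{2N}}{1-a^2}-N\right]. \] (2) The following limiting relation holds: \[ \hat Z_N(a)\overset{d}{\to} Z_*(a)\quad\text{as } N\to\infty,\qquad\text{where}\quad Z_*(a)\overset{d}{=}\sum_{k=1}^\infty\frac{U_k(a)}{a^k}, \] and $U_k(a)$, $k=1,2,\ldots$, is an infinite sequence of independent copies of a random variable $U(a)$ which is absolutely continuous and uniformly distributed over the interval $\left[-3\sqrt{\frac{a^2-1}{3}},\ 3\sqrt{\frac{a^2-1}{3}}\right]$.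
   Context: For an integer $a\ge2$ and an integer $N\ge1$, let $X_1(a),\ldots,X_N(a)$ be independent random variables with ${\bf P}[X_j(a)=k]=a^{-j}$ for $k=0,1,\ldots,a^j-1$, and let $Z_N(a)=X_1(a)+\cdots+X_N(a)$. Set $\mu_N(a)={\bf E}Z_N(a)$, $\sigma_N^2(a)={\bf Var}\,Z_N(a)$ (with $\sigma_N(a)>0$) and $\hat Z_N(a)=(Z_N(a)-\mu_N(a))/\sigma_N(a)$. The symbols $\overset{d}{=}$ and $\overset{d}{\to}$ denote equality and convergence in distribution. *)

theory Defs
  imports "HOL-Probability.Probability"
begin

text \<open>The family \<open>X 1, \<dots>, X N\<close> lives on a probability space \<open>M\<close>; values of \<open>X\<close> outside
  the index range \<open>{1..N}\<close> are irrelevant. The point probabilities sum to one, so each \<open>X j\<close>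
  is almost surely one of the integers \<open>0, \<dots>, a ^ j - 1\<close>.\<close>

definition indep_discrete_uniforms ::
    "nat \<Rightarrow> nat \<Rightarrow> 'w measure \<Rightarrow> (nat \<Rightarrow> 'w \<Rightarrow> real) \<Rightarrow> bool" where
  "indep_discrete_uniforms a N M X \<longleftrightarrow>
     prob_space M \<and>
     prob_space.indep_vars M (\<lambda>_. borel) X {1..N} \<and>
     (\<forall>j\<in>{1..N}. \<forall>k<a ^ j. measure M {w \<in> space M. X j w = real k} = 1 / real a ^ j)"

definition Z_sum :: "nat \<Rightarrow> (nat \<Rightarrow> 'w \<Rightarrow> real) \<Rightarrow> 'w \<Rightarrow> real" where
  "Z_sum N X w = (\<Sum>j=1..N. X j w)"

definition Z_mean :: "nat \<Rightarrow> 'w measure \<Rightarrow> (nat \<Rightarrow> 'w \<Rightarrow> real) \<Rightarrow> real" where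
  "Z_mean N M X = prob_space.expectation M (Z_sum N X)"

definition Z_sd :: "nat \<Rightarrow> 'w measure \<Rightarrow> (nat \<Rightarrow> 'w \<Rightarrow> real) \<Rightarrow> real" where
  "Z_sd N M X = sqrt (prob_space.variance M (Z_sum N X))"

definition Z_hat :: "nat \<Rightarrow> 'w measure \<Rightarrow> (nat \<Rightarrow> 'w \<Rightarrow> real) \<Rightarrow> 'w \<Rightarrow> real" where
  "Z_hat N M X w = (Z_sum N X w - Z_mean N M X) / Z_sd N M X"

definition uniform_interval :: "nat \<Rightarrow> real set" where
  "uniform_interval a =
     {- (3 * sqrt (((real a)\<^sup>2 - 1) / 3)) .. 3 * sqrt (((real a)\<^sup>2 - 1) / 3)}"

definition iid_uniforms :: "nat \<Rightarrow> 'v measure \<Rightarrow> (nat \<Rightarrow> 'v \<Rightarrow> real) \<Rightarrow> bool" where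
  "iid_uniforms a P U \<longleftrightarrow>
     prob_space P \<and>
     prob_space.indep_vars P (\<lambda>_. borel) U {1..} \<and>
     (\<forall>k\<ge>1. distributed P lborel (U k)
        (\<lambda>x. indicator (uniform_interval a) x / measure lborel (uniform_interval a)))"

text \<open>The sum over \<open>k \<ge> 1\<close>, shifted to start at \<open>k = 0\<close>.\<close>

definition U_series :: "nat \<Rightarrow> (nat \<Rightarrow> 'v \<Rightarrow> real) \<Rightarrow> 'v \<Rightarrow> real" where
  "U_series a U w = (\<Sum>k. U (Suc k) w / real a ^ Suc k)"

end

theory Submission
  imports Defs
begin

text \<open>
  The moments come from summing those of the independent uniform variables \<open>X j\<close>, where
  \<open>X j\<close> has mean \<open>(a ^ j - 1) / 2\<close> and variance \<open>(a ^ (2 * j) - 1) / 12\<close>. The limit theorem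
  is proved by a coupling. Let \<open>{-c..c}\<close> be the interval on
  which the \<open>U k\<close> are uniform. Cutting it into \<open>a ^ j\<close> cells of equal length and recording
  the index of the cell that contains \<open>U (Suc N - j)\<close> gives a variable uniform on
  \<open>{0..<a ^ j}\<close>; distinct \<open>j\<close> use distinct, hence independent, \<open>U k\<close>. So the standardised
  \<open>Z_sum\<close> has the law of a variable \<open>W N\<close> that is a function of \<open>U 1, \<dots>, U N\<close>
  (\<open>Z_hat_coupling\<close>).

  The cell index differs from its continuous version
  \<open>a ^ j * (U (Suc N - j) + c) / (2 * c) - 1 / 2\<close> by a bounded amount, so with \<open>\<sigma>\<close> the
  standard deviation of \<open>Z_sum\<close>
  \<open>W N = a ^ (N + 1) / (2 * c * \<sigma>) * (\<Sum>k=1..N. U k / a ^ k) + O(N / \<sigma>)\<close>.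
  The reversal \<open>k = N + 1 - j\<close> is what turns the weights \<open>a ^ j\<close> into \<open>1 / a ^ k\<close> times a
  common factor. As \<open>\<sigma>\<close> grows like \<open>a ^ N\<close>, the error vanishes, and the value of
  \<open>c\<close> is exactly the one for which the prefactor tends to 1 (\<open>scale_limits\<close>). Hence
  \<open>W N\<close> converges almost surely to \<open>U_series\<close> (\<open>standardised_rounded_sum_tendsto\<close>), which
  implies convergence in distribution (\<open>AE_tendsto_imp_weak_conv\<close>).
\<close>

section \<open>Discrete uniform variables\<close>

context prob_space
begin

text \<open>The \<open>n\<close> prescribed point masses already add up to one, so they determine the whole law.
  Writing the indicator of an event as a combination of the indicators of the atoms, first for
  the support and then for an arbitrary Borel set, expresses its probability through the masses.\<close>

lemma distr_discrete_uniform: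
  assumes X [measurable]: "random_variable borel X" and "n > 0"
    and mass: "\<And>k. k < n \<Longrightarrow> prob {w \<in> space M. X w = real k} = 1 / real n"
  shows "distr M borel X = distr (measure_pmf (pmf_of_set {..<n})) borel real"
proof (rule measure_eqI)
  fix A assume "A \<in> sets (distr M borel X)"
  then have A [measurable]: "A \<in> sets borel" by simp
  have sum_mass: "expectation (\<lambda>w. \<Sum>k<n. g k * indicator {w \<in> space M. X w = real k} w)
      = (\<Sum>k<n. g k) / real n" for g :: "nat \<Rightarrow> real"
  proof -
    have "integrable M (indicat_real {w \<in> space M. X w = real k})" for k
      by (rule integrable_real_indicator) (auto simp: less_top[symmetric])
    then show ?thesis
      by (subst Bochner_Integration.integral_sum)
         (simp_all add: mass sum_divide_distrib Int_def cong: conj_cong)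
  qed
  \<comment> \<open>On the atom \<open>X = k\<close> only the \<open>k\<close>-th term of such a combination survives.\<close>
  have pick: "(\<Sum>i<n. g i * indicator {w \<in> space M. X w = real i} w) = g k"
    if "w \<in> space M" "k < n" "X w = real k" for g :: "nat \<Rightarrow> real" and w k
  proof -
    have "(\<Sum>i<n. g i * indicator {w \<in> space M. X w = real i} w) = (\<Sum>i<n. if k = i then g i else 0)"
      using that by (intro sum.cong) (auto simp: indicator_def)
    then show ?thesis using that by simp
  qed
  have "prob {w \<in> space M. \<exists>k<n. X w = real k} = expectation (indicator {w \<in> space M. \<exists>k<n. X w = real k})"
    by simp
  also have "\<dots> = expectation (\<lambda>w. \<Sum>k<n. 1 * indicator {w \<in> space M. X w = real k} w)"
  proof (rule Bochner_Integration.integral_cong)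
    fix w assume w: "w \<in> space M"
    show "indicator {w \<in> space M. \<exists>k<n. X w = real k} w = (\<Sum>k<n. 1 * indicator {w \<in> space M. X w = real k} w :: real)"
    proof (cases "\<exists>k<n. X w = real k")
      case True
      then obtain k where "k < n" "X w = real k" by auto
      then have "(\<Sum>k<n. 1 * indicator {w \<in> space M. X w = real k} w) = (1 :: real)"
        by (rule pick[OF w])
      then show ?thesis using True w by simp
    qed (auto simp: indicator_def)
  qed simp
  also have "\<dots> = 1" using \<open>n > 0\<close> by (subst sum_mass) simp
  finally have "prob {w \<in> space M. \<exists>k<n. X w = real k} = 1" .
  then have supp: "AE w in M. \<exists>k<n. X w = real k"
    by (subst (asm) prob_eq_1) (auto elim: AE_mp)
  have "prob {w \<in> space M. X w \<in> A} = expectation (indicator {w \<in> space M. X w \<in> A})"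
    by simp
  also have "\<dots> = expectation (\<lambda>w. \<Sum>k<n. indicator A (real k) * indicator {w \<in> space M. X w = real k} w)"
  proof (rule integral_cong_AE)
    show "AE w in M. indicator {w \<in> space M. X w \<in> A} w =
        (\<Sum>k<n. indicator A (real k) * indicator {w \<in> space M. X w = real k} w :: real)"
      using supp AE_space
    proof eventually_elim
      case (elim w)
      then obtain k where k: "k < n" "X w = real k" by auto
      show ?case
        using elim(2) by (subst pick[OF elim(2) k]) (simp add: indicator_def k)
    qed
  next
    show "(\<lambda>w. \<Sum>k<n. indicat_real A (real k) * indicator {w \<in> space M. X w = real k} w) \<in> borel_measurable M"
      by (intro borel_measurable_sum borel_measurable_times borel_measurable_const borel_measurable_indicator) measurable
  qed measurable
  also have "\<dots> = (\<Sum>k<n. indicator A (real k)) / real n" by (rule sum_mass)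
  also have "\<dots> = real (card ({..<n} \<inter> real -` A)) / real n"
    by (simp add: indicator_def of_bool_def sum.If_cases Int_def)
  also have "\<dots> = measure (measure_pmf (pmf_of_set {..<n})) (real -` A)"
    using \<open>n > 0\<close> by (subst measure_pmf_of_set) auto
  finally have eq: "prob {w \<in> space M. X w \<in> A} = measure (measure_pmf (pmf_of_set {..<n})) (real -` A)" .
  have "emeasure (distr M borel X) A = ennreal (prob {w \<in> space M. X w \<in> A})"
    by (simp add: emeasure_distr emeasure_eq_measure vimage_def Int_def conj_commute)
  then show "emeasure (distr M borel X) A = emeasure (distr (measure_pmf (pmf_of_set {..<n})) borel real) A"
    by (simp add: eq emeasure_distr measure_pmf.emeasure_eq_measure)
qed simp

lemma expectation_discrete_uniform:
  fixes f :: "real \<Rightarrow> real"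
  assumes X [measurable]: "random_variable borel X" and n: "n > 0"
    and mass: "\<And>k. k < n \<Longrightarrow> prob {w \<in> space M. X w = real k} = 1 / real n"
    and f [measurable]: "f \<in> borel_measurable borel"
  shows "integrable M (\<lambda>w. f (X w))"
    and "expectation (\<lambda>w. f (X w)) = (\<Sum>k<n. f (real k)) / real n"
proof -
  note law = distr_discrete_uniform[OF X n mass]
  have fin: "finite (set_pmf (pmf_of_set {..<n}))" using n by (subst set_pmf_of_set) auto
  have "integrable (distr M borel X) f"
    by (simp add: law integrable_distr_eq integrable_measure_pmf_finite[OF fin])
  then show "integrable M (\<lambda>w. f (X w))" by (simp add: integrable_distr_eq)
  have "expectation (\<lambda>w. f (X w)) = integral\<^sup>L (distr M borel X) f" by (simp add: integral_distr)
  also have "\<dots> = (\<Sum>k<n. f (real k)) / real n"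
    using n by (simp add: law integral_distr integral_pmf_of_set lessThan_empty_iff)
  finally show "expectation (\<lambda>w. f (X w)) = (\<Sum>k<n. f (real k)) / real n" .
qed

section \<open>Independent families\<close>

text \<open>The additivity of variance (Bienayme's identity): each new summand is independent of the
  partial sum, so the cross term factors into a product of vanishing means.\<close>

lemma expectation_square_sum_indep_centred:
  fixes Y :: "'i \<Rightarrow> 'a \<Rightarrow> real"
  assumes "finite I" "indep_vars (\<lambda>_. borel) Y I"
    and "\<And>i. i \<in> I \<Longrightarrow> integrable M (Y i)"
    and "\<And>i. i \<in> I \<Longrightarrow> integrable M (\<lambda>w. (Y i w)\<^sup>2)"
    and "\<And>i. i \<in> I \<Longrightarrow> expectation (Y i) = 0"
  shows "integrable M (\<lambda>w. (\<Sum>i\<in>I. Y i w)\<^sup>2) \<and>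
    expectation (\<lambda>w. (\<Sum>i\<in>I. Y i w)\<^sup>2) = (\<Sum>i\<in>I. expectation (\<lambda>w. (Y i w)\<^sup>2))"
  using assms
proof (induction I rule: finite_induct)
  case empty
  then show ?case by simp
next
  case (insert i I)
  let ?S = "\<lambda>w. \<Sum>i\<in>I. Y i w"
  have IH: "integrable M (\<lambda>w. (?S w)\<^sup>2)"
      "expectation (\<lambda>w. (?S w)\<^sup>2) = (\<Sum>i\<in>I. expectation (\<lambda>w. (Y i w)\<^sup>2))"
    using insert.IH insert.prems indep_vars_subset[OF insert.prems(1)] by auto
  have indep: "indep_var borel (Y i) borel ?S"
    using insert by (intro indep_vars_sum)
  have int: "integrable M (Y i)" "integrable M ?S" using insert.prems by auto
  have cross: "integrable M (\<lambda>w. Y i w * ?S w)" "expectation (\<lambda>w. Y i w * ?S w) = 0"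
    using indep_var_integrable[OF indep int] indep_var_lebesgue_integral[OF indep int] insert.prems(4)
    by simp_all
  have sq: "(\<Sum>j\<in>insert i I. Y j w)\<^sup>2 = (Y i w)\<^sup>2 + 2 * (Y i w * ?S w) + (?S w)\<^sup>2" for w
    using insert.hyps by (simp add: power2_sum)
  show ?case
    unfolding sq using cross IH insert.prems(3) insert.hyps by simp
qed

text \<open>Independence is a condition on finite sets of indices, and an injection transports those.
  The coupling needs it to read the \<open>U k\<close> in reverse order.\<close>

lemma indep_vars_reindex:
  assumes indep: "indep_vars M' X I" and inj: "inj_on f J" and sub: "f ` J \<subseteq> I"
  shows "indep_vars (\<lambda>j. M' (f j)) (\<lambda>j. X (f j)) J"
  unfolding indep_vars_def2
proof (intro conjI ballI indep_setsI)
  fix j assume j: "j \<in> J"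
  show rv: "random_variable (M' (f j)) (X (f j))"
    using indep sub j by (auto simp: indep_vars_def2)
  show "{X (f j) -` A \<inter> space M |A. A \<in> sets (M' (f j))} \<subseteq> events"
    using measurable_sets[OF rv] by auto
next
  fix A K
  assume K: "K \<noteq> {}" "K \<subseteq> J" "finite K"
    and A: "\<forall>j\<in>K. A j \<in> {X (f j) -` A \<inter> space M |A. A \<in> sets (M' (f j))}"
  have injK: "inj_on f K" using inj K inj_on_subset by blast
  let ?g = "the_inv_into K f"
  have g: "?g (f j) = j" if "j \<in> K" for j using injK that by (rule the_inv_into_f_f)
  have "prob (\<Inter>i\<in>f ` K. A (?g i)) = (\<Prod>i\<in>f ` K. prob (A (?g i)))"
  proof (rule indep_setsD)
    show "indep_sets (\<lambda>i. {X i -` A \<inter> space M |A. A \<in> sets (M' i)}) I"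
      using indep by (simp add: indep_vars_def2)
    show "\<forall>i\<in>f ` K. A (?g i) \<in> {X i -` A \<inter> space M |A. A \<in> sets (M' i)}"
      using A g by auto
  qed (use K sub in auto)
  then show "prob (\<Inter>j\<in>K. A j) = (\<Prod>j\<in>K. prob (A j))"
    by (simp add: prod.reindex[OF injK] g cong: INF_cong_simp)
qed

section \<open>Rounding a continuous uniform variable\<close>

lemma uniform_prob_greaterThanAtMost:
  fixes p q s t :: real
  assumes D: "distributed M lborel U (\<lambda>x. indicator {p..q} x / measure lborel {p..q})"
    and "p \<le> s" "s \<le> t" "t \<le> q"
  shows "prob {w \<in> space M. s < U w \<and> U w \<le> t} = (t - s) / (q - p)"
proof -
  have [measurable]: "random_variable borel U" using distributed_measurable[OF D] by simp
  have "{w \<in> space M. s < U w \<and> U w \<le> t} = {w \<in> space M. U w \<le> t} - {w \<in> space M. U w \<le> s}"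
    by auto
  moreover have "prob \<dots> = prob {w \<in> space M. U w \<le> t} - prob {w \<in> space M. U w \<le> s}"
    using \<open>s \<le> t\<close> by (intro finite_measure_Diff) auto
  ultimately show ?thesis
    using assms uniform_distributed_measure[OF D]
    by (simp add: diff_divide_distrib)
qed

lemma uniform_AE_bounds:
  fixes p q :: real
  assumes D: "distributed M lborel U (\<lambda>x. indicator {p..q} x / measure lborel {p..q})"
  shows "AE w in M. p \<le> U w \<and> U w \<le> q"
proof -
  have "p < q" by (rule uniform_distributed_bounds[OF D])
  have [measurable]: "random_variable borel U" using distributed_measurable[OF D] by simp
  have "prob {w \<in> space M. p < U w \<and> U w \<le> q} = 1"
    using uniform_prob_greaterThanAtMost[OF D] \<open>p < q\<close> by simp
  then show ?thesis by (subst (asm) prob_eq_1) (auto elim: AE_mp)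
qed

text \<open>The ceiling minus one is the index of the cell, among \<open>n\<close> half-open cells
  \<open>{p + k * h<..p + (k + 1) * h}\<close> of length \<open>h = (q - p) / n\<close>, that contains \<open>U\<close>. Cells closed
  on the right make the event a difference of two values of the distribution function; this is
  why the ceiling is used and not the floor.\<close>

lemma uniform_rounding_mass:
  fixes p q :: real
  assumes D: "distributed M lborel U (\<lambda>x. indicator {p..q} x / measure lborel {p..q})"
    and "k < n"
  shows "prob {w \<in> space M. real_of_int (\<lceil>real n * (U w - p) / (q - p)\<rceil> - 1) = real k} = 1 / real n"
proof -
  have "p < q" by (rule uniform_distributed_bounds[OF D])
  define h where "h = (q - p) / real n"
  have n: "real n > 0" and h: "h > 0" "real n * h = q - p" using \<open>k < n\<close> \<open>p < q\<close> by (auto simp: h_def)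
  have "real_of_int (\<lceil>real n * (u - p) / (q - p)\<rceil> - 1) = real k \<longleftrightarrow> p + k * h < u \<and> u \<le> p + (k + 1) * h" for u
  proof -
    have "real_of_int (\<lceil>real n * (u - p) / (q - p)\<rceil> - 1) = real k \<longleftrightarrow> \<lceil>real n * (u - p) / (q - p)\<rceil> = int k + 1"
      by linarith
    also have "\<dots> \<longleftrightarrow> \<lceil>(u - p) / h\<rceil> = int k + 1" using n h by (simp add: h_def mult.commute)
    also have "\<dots> \<longleftrightarrow> real k < (u - p) / h \<and> (u - p) / h \<le> real k + 1"
      by (simp add: ceiling_eq_iff)
    also have "\<dots> \<longleftrightarrow> p + k * h < u \<and> u \<le> p + (k + 1) * h"
      using h by (simp add: pos_less_divide_eq pos_divide_le_eq algebra_simps)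
    finally show ?thesis .
  qed
  moreover have "prob {w \<in> space M. p + k * h < U w \<and> U w \<le> p + (k + 1) * h} = ((p + (k + 1) * h) - (p + k * h)) / (q - p)"
  proof (rule uniform_prob_greaterThanAtMost[OF D])
    have "(real k + 1) * h \<le> real n * h"
      using \<open>k < n\<close> h by (intro mult_right_mono) auto
    then show "p + (k + 1) * h \<le> q" using h by (simp add: add.commute)
  qed (use h in \<open>auto simp: algebra_simps\<close>)
  moreover have "((p + (k + 1) * h) - (p + k * h)) / (q - p) = 1 / real n"
    using \<open>p < q\<close> n by (simp add: h_def field_simps)
  ultimately show ?thesis by simp
qed

end

section \<open>Transfer of laws and weak convergence\<close>

text \<open>For independent variables the joint law is the product of the marginal laws, so equality of
  the marginals gives equality of the joint laws and of their images under summation. The two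
  families may live on different probability spaces.\<close>

lemma distr_sum_indep_eq:
  fixes X :: "'i \<Rightarrow> 'a \<Rightarrow> real" and Y :: "'i \<Rightarrow> 'b \<Rightarrow> real"
  assumes "prob_space M" "prob_space P" and I: "I \<noteq> {}"
    and X: "prob_space.indep_vars M (\<lambda>_. borel) X I"
    and Y: "prob_space.indep_vars P (\<lambda>_. borel) Y I"
    and law: "\<And>i. i \<in> I \<Longrightarrow> distr M borel (X i) = distr P borel (Y i)"
  shows "distr M borel (\<lambda>w. \<Sum>i\<in>I. X i w) = distr P borel (\<lambda>w. \<Sum>i\<in>I. Y i w)"
proof -
  interpret M: prob_space M by fact
  interpret P: prob_space P by fact
  have [measurable]: "\<And>i. i \<in> I \<Longrightarrow> X i \<in> borel_measurable M" "\<And>i. i \<in> I \<Longrightarrow> Y i \<in> borel_measurable P"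
    using X Y by (auto simp: M.indep_vars_def2 P.indep_vars_def2)
  have "distr M (Pi\<^sub>M I (\<lambda>_. borel)) (\<lambda>w. \<lambda>i\<in>I. X i w) = distr P (Pi\<^sub>M I (\<lambda>_. borel)) (\<lambda>w. \<lambda>i\<in>I. Y i w)"
    using X Y I by (simp add: M.indep_vars_iff_distr_eq_PiM' P.indep_vars_iff_distr_eq_PiM' law cong: PiM_cong)
  then have "distr (distr M (Pi\<^sub>M I (\<lambda>_. borel)) (\<lambda>w. \<lambda>i\<in>I. X i w)) borel (\<lambda>x. \<Sum>i\<in>I. x i)
      = distr (distr P (Pi\<^sub>M I (\<lambda>_. borel)) (\<lambda>w. \<lambda>i\<in>I. Y i w)) borel (\<lambda>x. \<Sum>i\<in>I. x i)"
    by simp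
  then show ?thesis
    by (simp add: distr_distr comp_def cong: sum.cong)
qed

text \<open>Dominated convergence gives convergence of the expectations of all bounded continuous
  functions, which characterises weak convergence.\<close>

lemma AE_tendsto_imp_weak_conv:
  fixes W :: "nat \<Rightarrow> 'v \<Rightarrow> real"
  assumes "prob_space P"
    and W [measurable]: "\<And>n. W n \<in> borel_measurable P" and S [measurable]: "S \<in> borel_measurable P"
    and lim: "AE w in P. (\<lambda>n. W n w) \<longlonglongrightarrow> S w"
  shows "weak_conv_m (\<lambda>n. distr P borel (W n)) (distr P borel S)"
proof -
  interpret prob_space P by fact
  show ?thesis
  proof (rule integral_bdd_continuous_conv_imp_weak_conv)
    fix f :: "real \<Rightarrow> real"
    assume cont: "\<And>x. isCont f x" and bdd: "\<And>x. \<bar>f x\<bar> \<le> 1"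
    have [measurable]: "f \<in> borel_measurable borel"
      using cont by (intro borel_measurable_continuous_onI continuous_at_imp_continuous_on) auto
    have "(\<lambda>n. \<integral>w. f (W n w) \<partial>P) \<longlonglongrightarrow> (\<integral>w. f (S w) \<partial>P)"
    proof (rule integral_dominated_convergence[where w="\<lambda>_. 1"])
      show "AE w in P. (\<lambda>n. f (W n w)) \<longlonglongrightarrow> f (S w)"
        using lim by eventually_elim (rule isCont_tendsto_compose[OF cont])
    qed (use bdd in auto)
    then show "(\<lambda>n. integral\<^sup>L (distr P borel (W n)) f) \<longlonglongrightarrow> integral\<^sup>L (distr P borel S) f"
      by (simp add: integral_distr)
  qed auto
qed


section \<open>Mean and variance of the sum\<close>

lemma sum_geometric_shifts:
  fixes x :: real
  assumes "x > 1"
  shows "(\<Sum>j=1..N. (x ^ j - 1) / 2) = 1/2 * (x * ((x ^ N - 1) / (x - 1)) - real N)"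
    and "(\<Sum>j=1..N. ((x ^ j)\<^sup>2 - 1) / 12) = 1/12 * (x\<^sup>2 * ((1 - x ^ (2 * N)) / (1 - x\<^sup>2)) - real N)"
proof -
  show "(\<Sum>j=1..N. (x ^ j - 1) / 2) = 1/2 * (x * ((x ^ N - 1) / (x - 1)) - real N)"
    using assms by (induction N) (simp_all add: field_simps)
  have "x\<^sup>2 > 1" using assms by (simp add: one_less_power)
  then show "(\<Sum>j=1..N. ((x ^ j)\<^sup>2 - 1) / 12) = 1/12 * (x\<^sup>2 * ((1 - x ^ (2 * N)) / (1 - x\<^sup>2)) - real N)"
    by (induction N) (simp_all add: field_simps power_mult power2_eq_square power_mult_distrib)
qed

lemma sum_lessThan_moments:
  "(\<Sum>k<n. real k) = real n * (real n - 1) / 2"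
  "(\<Sum>k<n. (real k - m)\<^sup>2) = real n * (real n - 1) * (2 * real n - 1) / 6 - m * real n * (real n - 1) + real n * m\<^sup>2"
  by (induction n) (simp_all add: field_simps power2_eq_square)

lemma moments_Z_sum:
  assumes a: "a \<ge> 2" and X: "indep_discrete_uniforms a N M X"
  shows "Z_mean N M X = 1/2 * (real a * ((real a ^ N - 1) / (real a - 1)) - real N)"
    and "prob_space.variance M (Z_sum N X) =
          1/12 * ((real a)\<^sup>2 * ((1 - real a ^ (2 * N)) / (1 - (real a)\<^sup>2)) - real N)"
proof -
  interpret prob_space M using X by (simp add: indep_discrete_uniforms_def)
  have indep: "indep_vars (\<lambda>_. borel) X {1..N}" using X by (simp add: indep_discrete_uniforms_def)
  define m where "m j = (real a ^ j - 1) / 2" for j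
  have rv: "random_variable borel (X j)" if "j \<in> {1..N}" for j
    using indep that by (auto simp: indep_vars_def2)
  have mass: "prob {w \<in> space M. X j w = real k} = 1 / real (a ^ j)" if "j \<in> {1..N}" "k < a ^ j" for j k
    using X that by (simp add: indep_discrete_uniforms_def)
  have pos: "a ^ j > 0" for j using a by simp
  note E = expectation_discrete_uniform[OF rv pos mass]
  have int1: "integrable M (X j)" if "j \<in> {1..N}" for j
    using E(1)[OF that that, of "\<lambda>x. x"] by simp
  have mean: "expectation (X j) = m j" if "j \<in> {1..N}" for j
    using E(2)[OF that that, of "\<lambda>x. x"] a
    by (simp add: sum_lessThan_moments m_def)
  have int2: "integrable M (\<lambda>w. (X j w - m j)\<^sup>2)" if "j \<in> {1..N}" for j
    using E(1)[OF that that, of "\<lambda>x. (x - m j)\<^sup>2"] by simp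
  have var: "expectation (\<lambda>w. (X j w - m j)\<^sup>2) = ((real a ^ j)\<^sup>2 - 1) / 12" if "j \<in> {1..N}" for j
  proof -
    define n where "n = real a ^ j"
    have "n > 0" using pos[of j] by (simp add: n_def flip: of_nat_power)
    have "expectation (\<lambda>w. (X j w - m j)\<^sup>2) =
        (n * (n - 1) * (2 * n - 1) / 6 - m j * n * (n - 1) + n * (m j)\<^sup>2) / n"
      using E(2)[OF that that, of "\<lambda>x. (x - m j)\<^sup>2"] by (simp add: sum_lessThan_moments n_def)
    also have "\<dots> = (n\<^sup>2 - 1) / 12"
      using \<open>n > 0\<close> unfolding m_def n_def[symmetric] by (simp add: field_simps power2_eq_square)
    finally show ?thesis by (simp add: n_def)
  qed
  have a1: "real a > 1" using a by simp
  have Zm: "expectation (Z_sum N X) = (\<Sum>j=1..N. m j)"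
    unfolding Z_sum_def using int1 mean by (subst Bochner_Integration.integral_sum) auto
  then show "Z_mean N M X = 1/2 * (real a * ((real a ^ N - 1) / (real a - 1)) - real N)"
    unfolding Z_mean_def m_def sum_geometric_shifts(1)[OF a1] .
  have "variance (Z_sum N X) = expectation (\<lambda>w. (\<Sum>j=1..N. X j w - m j)\<^sup>2)"
    unfolding Zm by (simp add: Z_sum_def sum_subtractf)
  also have "\<dots> = (\<Sum>j=1..N. expectation (\<lambda>w. (X j w - m j)\<^sup>2))"
  proof (rule conjunct2[OF expectation_square_sum_indep_centred])
    show "indep_vars (\<lambda>_. borel) (\<lambda>j w. X j w - m j) {1..N}"
      by (rule indep_vars_compose2[OF indep, where Y = "\<lambda>j x. x - m j"]) simp
  qed (use int1 int2 mean in \<open>auto simp: prob_space\<close>)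
  also have "\<dots> = (\<Sum>j=1..N. ((real a ^ j)\<^sup>2 - 1) / 12)" by (simp add: var)
  finally show "variance (Z_sum N X) =
          1/12 * ((real a)\<^sup>2 * ((1 - real a ^ (2 * N)) / (1 - (real a)\<^sup>2)) - real N)"
    unfolding sum_geometric_shifts(2)[OF a1] .
qed

section \<open>Convergence of the standardised rounded sums\<close>

text \<open>Here \<open>V\<close> is the closed form of the variance, which is asymptotic to
  \<open>x ^ (2 * N + 2) / (12 * (x\<^sup>2 - 1))\<close>. Since \<open>(2 * c)\<^sup>2 = 12 * (x\<^sup>2 - 1)\<close>, the
  normalisation \<open>sqrt (V N)\<close> is asymptotic to \<open>x ^ Suc N / (2 * c)\<close>: the half-length \<open>c\<close> is
  tuned to this limit, and the polynomial factor \<open>N\<close> is negligible against the exponential.\<close>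

lemma scale_limits:
  fixes x c :: real and V :: "nat \<Rightarrow> real"
  assumes x: "x > 1" and c: "c = 3 * sqrt ((x\<^sup>2 - 1) / 3)"
    and V: "\<And>N. V N = 1/12 * (x\<^sup>2 * ((1 - x ^ (2 * N)) / (1 - x\<^sup>2)) - real N)"
  shows "(\<lambda>N. x ^ Suc N / (2 * c * sqrt (V N))) \<longlonglongrightarrow> 1"
    and "(\<lambda>N. real N / sqrt (V N)) \<longlonglongrightarrow> 0"
proof -
  have x2: "x\<^sup>2 > 1" using x by (simp add: one_less_power)
  have c2: "c\<^sup>2 = 3 * (x\<^sup>2 - 1)" using x2 by (simp add: c power_mult_distrib)
  have "c > 0" using x2 by (simp add: c)
  \<comment> \<open>\<open>D\<close> is \<open>V\<close> divided by its leading term.\<close>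
  define D where "D N = 1 - (1 / x\<^sup>2) ^ N - (x\<^sup>2 - 1) / x\<^sup>2 * (real N * (1 / x\<^sup>2) ^ N)" for N
  have geo: "norm (1 / x\<^sup>2) < 1" "norm (1 / x) < 1" using x x2 by simp_all
  have "D \<longlonglongrightarrow> 1 - 0 - (x\<^sup>2 - 1) / x\<^sup>2 * 0"
    unfolding D_def by (intro tendsto_intros LIMSEQ_power_zero powser_times_n_limit_0 geo)
  then have "D \<longlonglongrightarrow> 1" by simp
  then have lim: "(\<lambda>N. sqrt (1 / D N)) \<longlonglongrightarrow> sqrt (1 / 1)"
    by (intro tendsto_intros) auto
  have r: "x ^ Suc N / (2 * c * sqrt (V N)) = sqrt (1 / D N)" for N
  proof -
    have "(2 * c)\<^sup>2 * V N = 12 * (x\<^sup>2 - 1) * V N" by (simp add: c2 power_mult_distrib)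
    also have "\<dots> = (x ^ Suc N)\<^sup>2 * D N"
      using x2 x by (simp add: V D_def field_simps power_mult power2_eq_square power_mult_distrib)
    finally have VD: "(2 * c)\<^sup>2 * V N = (x ^ Suc N)\<^sup>2 * D N" .
    have "x ^ Suc N / (2 * c * sqrt (V N)) = sqrt ((x ^ Suc N)\<^sup>2) / sqrt ((2 * c)\<^sup>2 * V N)"
      using x \<open>c > 0\<close> by (simp add: real_sqrt_mult)
    also have "\<dots> = sqrt ((x ^ Suc N)\<^sup>2) / (sqrt ((x ^ Suc N)\<^sup>2) * sqrt (D N))"
      by (simp only: VD real_sqrt_mult)
    also have "\<dots> = sqrt (1 / D N)" using x by (simp add: real_sqrt_divide)
    finally show ?thesis .
  qed
  show R: "(\<lambda>N. x ^ Suc N / (2 * c * sqrt (V N))) \<longlonglongrightarrow> 1" using lim by (simp only: r) simp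
  have "(\<lambda>N. (2 * c / x) * (real N * (1 / x) ^ N) * (x ^ Suc N / (2 * c * sqrt (V N)))) \<longlonglongrightarrow> (2 * c / x) * 0 * 1"
    by (intro tendsto_intros R powser_times_n_limit_0 geo)
  moreover have "(2 * c / x) * (real N * (1 / x) ^ N) * (x ^ Suc N / (2 * c * sqrt (V N))) = real N / sqrt (V N)" for N
    using x \<open>c > 0\<close> by (simp add: power_one_over)
  ultimately show "(\<lambda>N. real N / sqrt (V N)) \<longlonglongrightarrow> 0" by simp
qed

lemma summable_bounded_over_powers:
  fixes u :: "nat \<Rightarrow> real"
  assumes "x > 1" and u: "\<And>k. k \<ge> 1 \<Longrightarrow> \<bar>u k\<bar> \<le> c"
  shows "summable (\<lambda>k. u (Suc k) / x ^ Suc k)"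
proof (rule summable_comparison_test')
  show "summable (\<lambda>k. c / x * (1 / x) ^ k)"
    using \<open>x > 1\<close> by (intro summable_mult summable_geometric) simp
  show "norm (u (Suc k) / x ^ Suc k) \<le> c / x * (1 / x) ^ k" for k
    using u[of "Suc k"] \<open>x > 1\<close> by (simp add: power_one_over field_simps)
qed

text \<open>The deterministic core of the coupling: \<open>u\<close> is one realisation of the uniform variables.
  Each cell index minus its mean equals \<open>x ^ j * u (Suc N - j) / (2 * c)\<close> up to a bounded
  rounding error \<open>e N j\<close>; after division by \<open>sqrt (V N)\<close> the \<open>N\<close> errors together vanish, and
  the main part is a rescaled partial sum of the limiting series. The interval is written as
  \<open>{- c..c}\<close> with lower end \<open>- c\<close>, hence the terms \<open>- - c\<close>, to match the general form of the
  rounding map.\<close>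

lemma standardised_rounded_sum_tendsto:
  fixes x c :: real and V :: "nat \<Rightarrow> real" and u :: "nat \<Rightarrow> real"
  assumes x: "x > 1" and c: "c = 3 * sqrt ((x\<^sup>2 - 1) / 3)"
    and V: "\<And>N. V N = 1/12 * (x\<^sup>2 * ((1 - x ^ (2 * N)) / (1 - x\<^sup>2)) - real N)"
    and u: "\<And>k. k \<ge> 1 \<Longrightarrow> \<bar>u k\<bar> \<le> c"
  shows "(\<lambda>N. ((\<Sum>j=1..N. real_of_int (\<lceil>x ^ j * (u (Suc N - j) - - c) / (c - - c)\<rceil> - 1))
      - (\<Sum>j=1..N. (x ^ j - 1) / 2)) / sqrt (V N)) \<longlonglongrightarrow> (\<Sum>k. u (Suc k) / x ^ Suc k)"
proof -
  have "c > 0" using x by (simp add: c one_less_power)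
  define e where "e N j = real_of_int (\<lceil>x ^ j * (u (Suc N - j) - - c) / (c - - c)\<rceil> - 1)
      - x ^ j * (u (Suc N - j) - - c) / (c - - c) + 1 / 2" for N j
  have e: "\<bar>e N j\<bar> \<le> 1" for N j unfolding e_def by linarith
  have "(\<lambda>N. (\<Sum>j=1..N. e N j) / sqrt (V N)) \<longlonglongrightarrow> 0"
  proof (rule Lim_null_comparison[OF always_eventually scale_limits(2)[OF x c V]], rule allI)
    fix N
    have "\<bar>\<Sum>j=1..N. e N j\<bar> \<le> (\<Sum>j=1..N. 1)" using e by (intro order_trans[OF sum_abs] sum_mono)
    then have "\<bar>\<Sum>j=1..N. e N j\<bar> / \<bar>sqrt (V N)\<bar> \<le> real N / \<bar>sqrt (V N)\<bar>"
      by (intro divide_right_mono) simp_all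
    moreover have "V N \<ge> 0"
    proof -
      have "V N = (\<Sum>j=1..N. ((x ^ j)\<^sup>2 - 1) / 12)" unfolding V sum_geometric_shifts(2)[OF x] ..
      also have "\<dots> \<ge> 0" using x by (intro sum_nonneg) (simp add: one_le_power)
      finally show ?thesis .
    qed
    ultimately show "norm ((\<Sum>j=1..N. e N j) / sqrt (V N)) \<le> real N / sqrt (V N)" by simp
  qed
  have "(\<lambda>N. x ^ Suc N / (2 * c * sqrt (V N)) * (\<Sum>k<N. u (Suc k) / x ^ Suc k))
      \<longlonglongrightarrow> 1 * (\<Sum>k. u (Suc k) / x ^ Suc k)"
    by (intro tendsto_mult scale_limits(1)[OF x c V] summable_LIMSEQ summable_bounded_over_powers[OF x u])
  from tendsto_add[OF this \<open>(\<lambda>N. (\<Sum>j=1..N. e N j) / sqrt (V N)) \<longlonglongrightarrow> 0\<close>]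
  have "(\<lambda>N. x ^ Suc N / (2 * c * sqrt (V N)) * (\<Sum>k<N. u (Suc k) / x ^ Suc k)
      + (\<Sum>j=1..N. e N j) / sqrt (V N)) \<longlonglongrightarrow> 1 * (\<Sum>k. u (Suc k) / x ^ Suc k) + 0" .
  moreover have "x ^ Suc N / (2 * c * sqrt (V N)) * (\<Sum>k<N. u (Suc k) / x ^ Suc k)
      + (\<Sum>j=1..N. e N j) / sqrt (V N)
    = ((\<Sum>j=1..N. real_of_int (\<lceil>x ^ j * (u (Suc N - j) - - c) / (c - - c)\<rceil> - 1))
      - (\<Sum>j=1..N. (x ^ j - 1) / 2)) / sqrt (V N)" for N
  proof -
    \<comment> \<open>The zero-based index \<open>k\<close> of the series corresponds to \<open>j = N - k\<close>.\<close>
    have "x ^ Suc N * (\<Sum>k<N. u (Suc k) / x ^ Suc k) = (\<Sum>j=1..N. x ^ j * u (Suc N - j))"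
      unfolding sum_distrib_left
    proof (rule sum.reindex_bij_witness[of _ "\<lambda>j. N - j" "\<lambda>k. N - k"])
      fix k assume "k \<in> {..<N}"
      then have "Suc N = (N - k) + Suc k" and [simp]: "Suc N - (N - k) = Suc k" by auto
      then have "x ^ Suc N = x ^ (N - k) * x ^ Suc k" by (metis power_add)
      then show "x ^ (N - k) * u (Suc N - (N - k)) = x ^ Suc N * (u (Suc k) / x ^ Suc k)"
        using x by simp
    qed auto
    then have "x ^ Suc N / (2 * c) * (\<Sum>k<N. u (Suc k) / x ^ Suc k) = (\<Sum>j=1..N. x ^ j * u (Suc N - j) / (2 * c))"
      by (simp add: sum_divide_distrib)
    moreover have "real_of_int (\<lceil>x ^ j * (u (Suc N - j) - - c) / (c - - c)\<rceil> - 1) - (x ^ j - 1) / 2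
        = x ^ j * u (Suc N - j) / (2 * c) + e N j" for j
      using \<open>c > 0\<close> by (simp add: e_def field_simps)
    ultimately have "(\<Sum>j=1..N. real_of_int (\<lceil>x ^ j * (u (Suc N - j) - - c) / (c - - c)\<rceil> - 1))
        - (\<Sum>j=1..N. (x ^ j - 1) / 2) = x ^ Suc N / (2 * c) * (\<Sum>k<N. u (Suc k) / x ^ Suc k) + (\<Sum>j=1..N. e N j)"
      by (simp only: sum_subtractf[symmetric] sum.distrib)
    then show ?thesis by (simp add: add_divide_distrib)
  qed
  ultimately show ?thesis by simp
qed

section \<open>The coupling and the limit law\<close>

text \<open>By rounding \<open>U (Suc N - j)\<close> to a cell index, \<open>P\<close> carries a copy of the family \<open>X 1, \<dots>, X N\<close>.
  The reversed index gives the largest summand \<open>X N\<close> the variable \<open>U 1\<close> for every \<open>N\<close>, so the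
  copies for different \<open>N\<close> share their dominant terms and can converge pointwise.\<close>

lemma Z_hat_coupling:
  fixes M :: "'w measure" and P :: "'v measure"
  assumes a: "a \<ge> 2" and N: "N \<ge> 1" and X: "indep_discrete_uniforms a N M X" and U: "iid_uniforms a P U"
    and c: "c = 3 * sqrt (((real a)\<^sup>2 - 1) / 3)"
  shows "distr M borel (Z_hat N M X) = distr P borel
    (\<lambda>w. ((\<Sum>j=1..N. real_of_int (\<lceil>real a ^ j * (U (Suc N - j) w - - c) / (c - - c)\<rceil> - 1))
       - Z_mean N M X) / Z_sd N M X)"
proof -
  interpret M: prob_space M using X by (simp add: indep_discrete_uniforms_def)
  interpret P: prob_space P using U by (simp add: iid_uniforms_def)
  define R where "R j u = real_of_int (\<lceil>real a ^ j * (u - - c) / (c - - c)\<rceil> - 1)" for j u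
  have [measurable]: "R j \<in> borel_measurable borel" for j unfolding R_def by measurable
  have indepX: "M.indep_vars (\<lambda>_. borel) X {1..N}" using X by (simp add: indep_discrete_uniforms_def)
  then have [measurable]: "X j \<in> borel_measurable M" if "j \<in> {1..N}" for j
    using that by (auto simp: M.indep_vars_def2)
  have indepU: "P.indep_vars (\<lambda>_. borel) U {1..}" using U by (simp add: iid_uniforms_def)
  then have Um [measurable]: "U k \<in> borel_measurable P" if "k \<in> {1..}" for k
    using that by (auto simp: P.indep_vars_def2)
  have D: "distributed P lborel (U k) (\<lambda>x. indicator {- c..c} x / measure lborel {- c..c})" if "k \<ge> 1" for k
    using U that by (simp add: iid_uniforms_def uniform_interval_def c)
  have "P.indep_vars (\<lambda>_. borel) (\<lambda>j. U (Suc N - j)) {1..N}"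
    by (rule P.indep_vars_reindex[OF indepU]) (auto simp: inj_on_def)
  then have indepR: "P.indep_vars (\<lambda>_. borel) (\<lambda>j w. R j (U (Suc N - j) w)) {1..N}"
    by (rule P.indep_vars_compose2) simp
  have "distr M borel (\<lambda>w. \<Sum>j=1..N. X j w) = distr P borel (\<lambda>w. \<Sum>j=1..N. R j (U (Suc N - j) w))"
  proof (rule distr_sum_indep_eq[OF _ _ _ indepX indepR])
    fix j assume j: "j \<in> {1..N}"
    have pos: "a ^ j > 0" using a by simp
    have "distr M borel (X j) = distr (measure_pmf (pmf_of_set {..<a ^ j})) borel real"
      using X j by (intro M.distr_discrete_uniform pos) (auto simp: indep_discrete_uniforms_def)
    also have "\<dots> = distr P borel (\<lambda>w. R j (U (Suc N - j) w))"
    proof (rule P.distr_discrete_uniform[OF _ pos, symmetric])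
      show "(\<lambda>w. R j (U (Suc N - j) w)) \<in> borel_measurable P"
        using Um[of "Suc N - j"] j by auto
      show "P.prob {w \<in> space P. R j (U (Suc N - j) w) = real k} = 1 / real (a ^ j)" if "k < a ^ j" for k
        using P.uniform_rounding_mass[OF D that, of "Suc N - j"] j by (simp add: R_def Suc_le_eq)
    qed
    finally show "distr M borel (X j) = distr P borel (\<lambda>w. R j (U (Suc N - j) w))" .
  qed (use N in \<open>auto intro: M.prob_space_axioms P.prob_space_axioms\<close>)
  then have eq: "distr (distr M borel (\<lambda>w. \<Sum>j=1..N. X j w)) borel (\<lambda>z. (z - Z_mean N M X) / Z_sd N M X)
      = distr (distr P borel (\<lambda>w. \<Sum>j=1..N. R j (U (Suc N - j) w))) borel (\<lambda>z. (z - Z_mean N M X) / Z_sd N M X)"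
    by simp
  have [measurable]: "(\<lambda>w. R j (U (Suc N - j) w)) \<in> borel_measurable P" if "j \<in> {1..N}" for j
    using Um[of "Suc N - j"] that by auto
  show ?thesis
    using eq unfolding R_def[symmetric] by (simp add: distr_distr comp_def Z_hat_def[abs_def] Z_sum_def)
qed

theorem proposition5p1:
  fixes a :: nat
  assumes "a \<ge> 2"
  shows
    "(\<forall>N\<ge>1. \<forall>(M :: 'w measure) X. indep_discrete_uniforms a N M X \<longrightarrow>
        Z_mean N M X = 1/2 * (real a * ((real a ^ N - 1) / (real a - 1)) - real N) \<and>
        prob_space.variance M (Z_sum N X) =
          1/12 * ((real a)\<^sup>2 * ((1 - real a ^ (2 * N)) / (1 - (real a)\<^sup>2)) - real N))
     \<and>
     (\<forall>(M :: nat \<Rightarrow> 'w measure) X (P :: 'v measure) U (Q :: 'z measure) Z_star.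
        (\<forall>N\<ge>1. indep_discrete_uniforms a N (M N) (X N)) \<longrightarrow>
        iid_uniforms a P U \<longrightarrow>
        prob_space Q \<longrightarrow>
        Z_star \<in> borel_measurable Q \<longrightarrow>
        distr Q borel Z_star = distr P borel (U_series a U) \<longrightarrow>
        (AE w in P. summable (\<lambda>k. U (Suc k) w / real a ^ Suc k)) \<and>
        weak_conv_m (\<lambda>N. distr (M N) borel (Z_hat N (M N) (X N))) (distr Q borel Z_star))"
proof (intro conjI allI impI)
  fix N and M :: "'w measure" and X
  assume "indep_discrete_uniforms a N M X"
  then show "Z_mean N M X = 1/2 * (real a * ((real a ^ N - 1) / (real a - 1)) - real N)"
    and "prob_space.variance M (Z_sum N X) =
          1/12 * ((real a)\<^sup>2 * ((1 - real a ^ (2 * N)) / (1 - (real a)\<^sup>2)) - real N)"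
    by (rule moments_Z_sum[OF assms])+
next
  fix M :: "nat \<Rightarrow> 'w measure" and X and P :: "'v measure" and U and Q :: "'z measure" and Z_star
  assume X: "\<forall>N\<ge>1. indep_discrete_uniforms a N (M N) (X N)" and U: "iid_uniforms a P U"
    and law: "distr Q borel Z_star = distr P borel (U_series a U)"
  interpret P: prob_space P using U by (simp add: iid_uniforms_def)
  define c where "c = 3 * sqrt (((real a)\<^sup>2 - 1) / 3)"
  define V where "V N = 1/12 * ((real a)\<^sup>2 * ((1 - real a ^ (2 * N)) / (1 - (real a)\<^sup>2)) - real N)" for N
  have a1: "real a > 1" using assms by simp
  have Um [measurable]: "U k \<in> borel_measurable P" if "k \<ge> 1" for k
    using U that by (auto simp: iid_uniforms_def P.indep_vars_def2)
  have "AE w in P. \<forall>k. \<bar>U (Suc k) w\<bar> \<le> c"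
  proof (subst AE_all_countable, rule allI)
    fix k
    have "distributed P lborel (U (Suc k)) (\<lambda>x. indicator {- c..c} x / measure lborel {- c..c})"
      using U by (simp add: iid_uniforms_def uniform_interval_def c_def)
    from P.uniform_AE_bounds[OF this] show "AE w in P. \<bar>U (Suc k) w\<bar> \<le> c"
      by eventually_elim auto
  qed
  then have bdd: "AE w in P. \<forall>k\<ge>1. \<bar>U k w\<bar> \<le> c"
    by eventually_elim (metis Suc_le_D One_nat_def)
  then show "AE w in P. summable (\<lambda>k. U (Suc k) w / real a ^ Suc k)"
  proof eventually_elim
    case (elim w)
    show ?case by (rule summable_bounded_over_powers[OF a1, where c = c]) (use elim in blast)
  qed
  define W where "W N w = ((\<Sum>j=1..N. real_of_int (\<lceil>real a ^ j * (U (Suc N - j) w - - c) / (c - - c)\<rceil> - 1))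
      - (\<Sum>j=1..N. (real a ^ j - 1) / 2)) / sqrt (V N)" for N w
  have lawW: "distr (M N) borel (Z_hat N (M N) (X N)) = distr P borel (W N)" if "N \<ge> 1" for N
  proof -
    have XN: "indep_discrete_uniforms a N (M N) (X N)" using X that by blast
    show ?thesis
      unfolding Z_hat_coupling[OF assms that XN U c_def] W_def Z_sd_def moments_Z_sum[OF assms XN]
        V_def sum_geometric_shifts(1)[OF a1] ..
  qed
  have "weak_conv_m (\<lambda>N. distr P borel (W N)) (distr P borel (U_series a U))"
  proof (rule AE_tendsto_imp_weak_conv)
    show "W N \<in> borel_measurable P" for N
    proof -
      have "(\<lambda>w. U (Suc N - j) w) \<in> borel_measurable P" if "j \<in> {1..N}" for j
        using that by (intro Um) auto
      then show ?thesis unfolding W_def by simp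
    qed
    show "U_series a U \<in> borel_measurable P"
      unfolding U_series_def[abs_def] by simp
    show "AE w in P. (\<lambda>N. W N w) \<longlonglongrightarrow> U_series a U w"
      using bdd
    proof eventually_elim
      case (elim w)
      show ?case
        unfolding W_def U_series_def
        by (rule standardised_rounded_sum_tendsto[OF a1 c_def V_def]) (use elim in auto)
    qed
  qed (rule P.prob_space_axioms)
  \<comment> \<open>\<open>M 0\<close> and \<open>X 0\<close> are arbitrary, so the laws are only known to agree from index 1 on;
    this suffices for the pointwise limits of the distribution functions.\<close>
  then have lim: "(\<lambda>N. cdf (distr P borel (W N)) t) \<longlonglongrightarrow> cdf (distr Q borel Z_star) t"
    if "isCont (cdf (distr Q borel Z_star)) t" for t
    using that by (simp add: weak_conv_m_def weak_conv_def law)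
  show "weak_conv_m (\<lambda>N. distr (M N) borel (Z_hat N (M N) (X N))) (distr Q borel Z_star)"
    unfolding weak_conv_m_def weak_conv_def
  proof (intro allI impI)
    fix t assume "isCont (cdf (distr Q borel Z_star)) t"
    from lim[OF this]
    show "(\<lambda>N. cdf (distr (M N) borel (Z_hat N (M N) (X N))) t) \<longlonglongrightarrow> cdf (distr Q borel Z_star) t"
      by (rule Lim_transform_eventually)
         (auto simp: lawW intro!: eventually_mono[OF eventually_ge_at_top[of 1]])
  qed
qed

end
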